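(* Let $G\not\equiv0$ be an infinitesimal generator in $\mathbb{D}$ with Berkson-Porta decomposition $G(z)=(z-\tau)(\overline{\tau}z-1)p(z)$, where $\tau\in\overline{\mathbb{D}}$ and $p:\mathbb{D}\to\mathbb{C}$ is holomorphic with $\mathrm{Re}\,p\ge0$, and let $x=e^{i\theta}\in\partial\mathbb{D}$. Let $\mu$ be the positive finite Borel measure on $\partial\mathbb{D}$ which satisfies $$\frac1{p(z)}=\frac1{2\pi}\int_0^{2\pi}\frac{e^{it}+z}{e^{it}-z}\,d\mu(t)\qquad\text{for all }z\in\mathbb{D}.$$ Then $x$ is a regular pole of $G$ if and only if both $$\lim_{(0,1)\ni r\to1}\int_0^{2\pi}\frac{d\mu(t)}{|e^{it}-re^{i\theta}|^2}<+\infty$$ and $$\lim_{(0,1)\ni r\to1}\int_0^{2\pi}\frac{\sin(t-\theta)}{|e^{it}-re^{i\theta}|^2}\,\frac{d\mu(t)}{1-r}=0.$$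
   Context: $\mathbb{D}$ is the open unit disc in $\mathbb{C}$. A semigroup $(\phi_t)_{t\ge0}$ of holomorphic self-maps of $\mathbb{D}$ is a family of holomorphic maps $\phi_t:\mathbb{D}\to\mathbb{D}$ with $\phi_0=\mathrm{id}$, $\phi_{t+s}=\phi_t\circ\phi_s$, and $t\mapsto\phi_t$ continuous for uniform convergence on compacta. Its infinitesimal generator is the unique holomorphic $G:\mathbb{D}\to\mathbb{C}$ with $\partial_t\phi_t(z)=G(\phi_t(z))$ for all $t\ge 0$, $z\in\mathbb D$; an infinitesimal generator in $\mathbb D$ is a $G$ arising this way. Berkson-Porta formula: every infinitesimal generator $G\not\equiv0$ can be written uniquely as $G(z)=(z-\tau)(\overline{\tau}z-1)p(z)$ with $\tau\in\overline{\mathbb{D}}$ and $p:\mathbb{D}\to\mathbb{C}$ holomorphic with $\mathrm{Re}\,p\ge0$. A point $x\in\partial\mathbb{D}$ is a regular pole of $G$ if $\angle\liminf_{z\to x}|G(z)(x-z)|=C$ for some $C\in(0,+\infty)$, where $\angle\liminf$ is the lower limit as $z\to x$ non-tangentially, i.e. inside Stolz angles $\{z\in\mathbb{D}:|x-z|<R(1-|z|)\}$, $R>1$. The circle $\partial\mathbb{D}$ is parametrized by $t\mapsto e^{it}$, $t\in[0,2\pi)$.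
   Formalization: The formal statement adds the hypothesis x ≠ τ; at x = τ the equivalence fails, e.g. G(z) = 1 − z², τ = x = 1, μ = 2πδ at −1: both limit conditions hold but G(z)(1 − z) → 0, so x is not a regular pole. *)

theory Defs
  imports "HOL-Complex_Analysis.Complex_Analysis"
begin

definition holo_semigroup :: "(real \<Rightarrow> complex \<Rightarrow> complex) \<Rightarrow> bool" where
  "holo_semigroup \<phi> \<longleftrightarrow>
     (\<forall>t\<ge>0. \<phi> t holomorphic_on ball 0 1 \<and> \<phi> t ` ball 0 1 \<subseteq> ball 0 1) \<and>
     (\<forall>z\<in>ball 0 1. \<phi> 0 z = z) \<and>
     (\<forall>t\<ge>0. \<forall>s\<ge>0. \<forall>z\<in>ball 0 1. \<phi> (t + s) z = \<phi> t (\<phi> s z)) \<and>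
     (\<forall>t\<ge>0. \<forall>K. compact K \<and> K \<subseteq> ball 0 1 \<longrightarrow>
        uniform_limit K \<phi> (\<phi> t) (at t within {0..}))"

definition inf_generator :: "(complex \<Rightarrow> complex) \<Rightarrow> bool" where
  "inf_generator G \<longleftrightarrow>
     G holomorphic_on ball 0 1 \<and>
     (\<exists>\<phi>. holo_semigroup \<phi> \<and>
        (\<forall>t\<ge>0. \<forall>z\<in>ball 0 1.
           ((\<lambda>s. \<phi> s z) has_vector_derivative G (\<phi> t z)) (at t within {0..})))"

definition stolz_angle :: "complex \<Rightarrow> real \<Rightarrow> complex set" where
  "stolz_angle x R = {z \<in> ball 0 1. norm (x - z) < R * (1 - norm z)}"

text \<open>
  The Stolz angles at \<open>x\<close> grow with \<open>R\<close>, so the lower limits inside them decrease;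
  their infimum is the smallest cluster value of \<open>f\<close> along sequences
  that tend to \<open>x\<close> inside some Stolz angle.
\<close>

definition angular_liminf :: "complex \<Rightarrow> (complex \<Rightarrow> real) \<Rightarrow> ereal" where
  "angular_liminf x f =
     (INF R\<in>{1<..}. Liminf (at x within stolz_angle x R) (\<lambda>z. ereal (f z)))"

definition regular_pole :: "(complex \<Rightarrow> complex) \<Rightarrow> complex \<Rightarrow> bool" where
  "regular_pole G x \<longleftrightarrow>
     norm x = 1 \<and> (\<exists>C::real. C > 0 \<and> angular_liminf x (\<lambda>z. norm (G z * (x - z))) = ereal C)"

text \<open>
  For a measure \<open>\<mu>\<close> on the unit circle this is the integral of \<open>f t\<close> with respect to
  \<open>d\<mu>(t)\<close> over \<open>0 \<le> t < 2 pi\<close>: on the circle, \<open>Arg2pi\<close> is the inverse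
  of the parametrization \<open>cis\<close> restricted to \<open>{0..<2 * pi}\<close>.
\<close>

definition circle_integral ::
    "complex measure \<Rightarrow> (real \<Rightarrow> 'a::{banach, second_countable_topology}) \<Rightarrow> 'a" where
  "circle_integral \<mu> f = (\<integral>w. f (Arg2pi w) \<partial>\<mu>)"

end

theory Submission
  imports Defs
begin

text \<open>
  Write \<open>H z = \<integral> (w + z) / (w - z) d\<mu>(w)\<close>, so that \<open>p = 2 pi / H\<close>, and let
  \<open>I = \<integral> |w - x|^-2 d\<mu>(w)\<close>. Since \<open>Re (H z) = (1 - |z|^2) \<integral> |w - z|^-2 d\<mu>(w)\<close>, a radial
  bound \<open>|H (r x)| \<le> K (1 - r)\<close> forces \<open>I < \<infinity>\<close> by Fatou's lemma. Conversely, if \<open>I < \<infinity>\<close>,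
  dominated convergence yields the expansion
  \<open>H z = H x + 2 I (x - z) / x + o(|x - z|)\<close> inside Stolz angles, where \<open>H x\<close> is
  purely imaginary. Both the existence of a regular pole and the vanishing of the limit
  with the sine kernel then amount to \<open>H x = 0\<close>.
\<close>

section \<open>Kernel identities on the unit circle\<close>

text \<open>Expanding with the conjugate denominator and \<open>|w| = 1\<close> separates the
  Poisson kernel (real part) from the conjugate Poisson kernel (imaginary part). The point
  \<open>z\<close> may also lie on the circle, where the real part vanishes.\<close>

lemma herglotz_kernel:
  assumes "norm w = 1" "w \<noteq> z"
  shows "(w + z) / (w - z) = Complex (1 - (norm z)\<^sup>2) (2 * Im (z * cnj w)) / (norm (w - z))\<^sup>2"
proof -
  have "(w + z) / (w - z) = (w + z) * cnj (w - z) / (norm (w - z))\<^sup>2"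
    by (rule complex_div_cnj)
  moreover have "(Re w)\<^sup>2 + (Im w)\<^sup>2 = 1"
    using assms by (simp flip: cmod_power2)
  hence "(w + z) * cnj (w - z) = Complex (1 - (norm z)\<^sup>2) (2 * Im (z * cnj w))"
    unfolding cmod_power2 by (simp add: complex_eq_iff algebra_simps power2_eq_square)
  ultimately show ?thesis by simp
qed

text \<open>The numerators combine to
  \<open>(w + z) * (w - x) - (w + x) * (w - z) = - 2 * w * (x - z)\<close>, so the increment
  \<open>x - z\<close> cancels and the quotient still makes sense in the limit
  \<open>z = x\<close>.\<close>

lemma herglotz_kernel_diff:
  fixes w x z :: complex
  assumes "norm w = 1" "norm x = 1" "w \<noteq> x" "w \<noteq> z" "x \<noteq> z"
  shows "((w + z) / (w - z) - (w + x) / (w - x)) / (x - z) = - 2 * (w / ((w - z) * (w - x)))"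
proof -
  have "(w + z) / (w - z) - (w + x) / (w - x) = - 2 * w * (x - z) / ((w - z) * (w - x))"
    using assms by (simp add: divide_simps) (simp add: algebra_simps)
  thus ?thesis using assms by simp
qed

text \<open>On the circle \<open>w * cnj (w - x) = 1 - w * cnj x = - cnj x * (w - x)\<close>. Hence
  the phase of this limit kernel is the same for all \<open>w\<close>, and its integral reduces to
  that of a positive function.\<close>

lemma unit_circle_quotient:
  fixes w x :: complex
  assumes "norm w = 1" "norm x = 1" "w \<noteq> x"
  shows "w / (w - x)\<^sup>2 = - cnj x / (norm (w - x))\<^sup>2"
proof -
  have w: "w * cnj w = 1" and x: "x * cnj x = 1"
    using assms by (simp_all add: complex_mult_cnj flip: cmod_power2)
  have "w * complex_of_real ((norm (w - x))\<^sup>2) = w * ((w - x) * cnj (w - x))"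
    by (simp only: complex_norm_square)
  also have "\<dots> = (w - x) * (w * cnj w - w * cnj x)"
    by (simp add: algebra_simps)
  also have "\<dots> = (w - x) * (x * cnj x - w * cnj x)"
    by (simp add: w x)
  also have "\<dots> = - cnj x * (w - x)\<^sup>2"
    by (simp add: algebra_simps power2_eq_square)
  finally show ?thesis
    using assms by (simp add: divide_simps)
qed

section \<open>Stolz angles and radial approach\<close>

text \<open>The triangle inequality through \<open>z\<close>, with
  \<open>|x - z| < R * (1 - |z|) \<le> R * |w - z|\<close>. It replaces \<open>|w - z|\<close> by
  \<open>|w - x|\<close> in denominators, which gives a majorant independent of
  \<open>z\<close>.\<close>

lemma stolz_angle_approach:
  assumes "z \<in> stolz_angle x R" "norm w = 1"
  shows "norm (w - x) \<le> (1 + R) * norm (w - z)"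
proof -
  have z: "norm z < 1" "norm (x - z) < R * (1 - norm z)"
    using assms by (auto simp: stolz_angle_def)
  have d: "1 - norm z \<le> norm (w - z)"
    using norm_triangle_ineq2[of w z] assms by simp
  have "0 < R * (1 - norm z)" using z(2) norm_ge_zero by (rule le_less_trans[rotated])
  hence "0 < R" using z(1) by (simp add: zero_less_mult_iff)
  hence "R * (1 - norm z) \<le> R * norm (w - z)" using d by simp
  moreover have "norm (w - x) \<le> norm (w - z) + norm (x - z)"
    by (metis dist_norm dist_triangle2)
  ultimately show ?thesis using z(2) by (simp add: algebra_simps)
qed

lemma norm_radial_diff:
  assumes "norm x = 1" "r \<le> 1"
  shows "norm (x - complex_of_real r * x) = 1 - r"
proof -
  have "norm (x - r * x) = norm (complex_of_real (1 - r)) * norm x"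
    by (simp flip: norm_mult add: algebra_simps)
  thus ?thesis using assms by (simp del: of_real_diff)
qed

lemma eventually_at_left_1: "eventually (\<lambda>r::real. 0 < r \<and> r < 1) (at_left 1)"
  by (rule eventually_mono[OF eventually_at_left_real[of 0 1]]) auto

text \<open>On the radius \<open>|x - z| = 1 - |z|\<close>, so it lies in every Stolz angle with
  \<open>R > 1\<close>; angular limits thus yield radial ones.\<close>

lemma filterlim_radial_stolz_angle:
  assumes "norm x = 1" "R > 1"
  shows "filterlim (\<lambda>r. complex_of_real r * x) (at x within stolz_angle x R) (at_left 1)"
  unfolding filterlim_at
proof
  show "eventually (\<lambda>r. complex_of_real r * x \<in> stolz_angle x R \<and> complex_of_real r * x \<noteq> x) (at_left 1)"
    using eventually_at_left_1
  proof eventually_elim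
    case (elim r)
    hence "norm (x - r * x) = 1 - r" using assms by (simp add: norm_radial_diff)
    thus ?case using elim assms by (auto simp: stolz_angle_def norm_mult)
  qed
  show "((\<lambda>r. complex_of_real r * x) \<longlongrightarrow> x) (at_left 1)"
    by (auto intro!: tendsto_eq_intros)
qed

section \<open>Herglotz and Poisson integrals inside the disc\<close>

locale circle_measure = finite_measure M for M :: "complex measure" +
  assumes sets_eq: "sets M = sets (restrict_space borel (sphere 0 1))"
begin

lemma space_eq: "space M = sphere 0 1"
  using sets_eq_imp_space_eq[OF sets_eq] by (simp add: space_restrict_space)

lemma norm_space [simp]: "w \<in> space M \<Longrightarrow> norm w = 1"
  by (simp add: space_eq)

lemma measurable_borel: "f \<in> borel_measurable borel \<Longrightarrow> f \<in> borel_measurable M"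
  using measurable_restrict_space1[of f borel borel "sphere 0 1"] measurable_cong_sets[OF sets_eq refl]
  by blast

lemma circle_integral_cis: "circle_integral M (\<lambda>t. g (cis t)) = (\<integral>w. g w \<partial>M)"
  unfolding circle_integral_def
proof (rule Bochner_Integration.integral_cong)
  fix w assume "w \<in> space M"
  thus "g (cis (Arg2pi w)) = g w"
    using Arg2pi_eq[of w] by (simp add: cis_conv_exp)
qed simp

definition herglotz :: "complex \<Rightarrow> complex" where
  "herglotz z = (\<integral>w. (w + z) / (w - z) \<partial>M)"

text \<open>The factor \<open>1 - |z|^2\<close> of the usual Poisson integral is left out, so that
  the value at a boundary point can be the integral \<open>I\<close>.\<close>

definition poisson :: "complex \<Rightarrow> real" where
  "poisson z = (\<integral>w. 1 / (norm (w - z))\<^sup>2 \<partial>M)"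

lemma dist_space_ge: "w \<in> space M \<Longrightarrow> 1 - norm z \<le> norm (w - z)"
  using norm_triangle_ineq2[of w z] by simp

lemma not_in_space: "w \<in> space M \<Longrightarrow> norm z < 1 \<Longrightarrow> w \<noteq> z"
  by force

lemma integrable_herglotz:
  assumes "norm z < 1"
  shows "integrable M (\<lambda>w. (w + z) / (w - z))"
proof (rule integrable_const_bound)
  show "AE w in M. norm ((w + z) / (w - z)) \<le> 2 / (1 - norm z)"
  proof (rule AE_I2)
    fix w assume w: "w \<in> space M"
    have "norm (w + z) \<le> 2" using norm_triangle_ineq[of w z] w assms by simp
    thus "norm ((w + z) / (w - z)) \<le> 2 / (1 - norm z)"
      unfolding norm_divide using dist_space_ge[OF w, of z] assms by (intro frac_le) auto
  qed
qed (rule measurable_borel, measurable)+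

lemma integrable_poisson:
  assumes "norm z < 1"
  shows "integrable M (\<lambda>w. 1 / (norm (w - z))\<^sup>2)"
proof (rule integrable_const_bound)
  show "AE w in M. norm (1 / (norm (w - z))\<^sup>2) \<le> 1 / (1 - norm z)\<^sup>2"
  proof (rule AE_I2)
    fix w assume w: "w \<in> space M"
    show "norm (1 / (norm (w - z))\<^sup>2) \<le> 1 / (1 - norm z)\<^sup>2"
      using dist_space_ge[OF w, of z] assms by (auto intro!: frac_le power_mono)
  qed
qed (rule measurable_borel, measurable)+

lemma Re_herglotz:
  assumes "norm z < 1"
  shows "Re (herglotz z) = (1 - (norm z)\<^sup>2) * poisson z"
proof -
  have "Re (herglotz z) = (\<integral>w. Re ((w + z) / (w - z)) \<partial>M)"
    unfolding herglotz_def using integrable_herglotz[OF assms] by (rule integral_Re[symmetric])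
  also have "\<dots> = (\<integral>w. (1 - (norm z)\<^sup>2) * (1 / (norm (w - z))\<^sup>2) \<partial>M)"
    by (rule Bochner_Integration.integral_cong)
       (simp_all add: herglotz_kernel not_in_space[OF _ assms] Re_divide_of_real)
  finally show ?thesis by (simp only: poisson_def integral_mult_right_zero)
qed

lemma Im_herglotz:
  assumes "norm z < 1"
  shows "Im (herglotz z) = 2 * (\<integral>w. Im (z * cnj w) / (norm (w - z))\<^sup>2 \<partial>M)"
proof -
  have "Im (herglotz z) = (\<integral>w. Im ((w + z) / (w - z)) \<partial>M)"
    unfolding herglotz_def using integrable_herglotz[OF assms] by (rule integral_Im[symmetric])
  also have "\<dots> = (\<integral>w. 2 * (Im (z * cnj w) / (norm (w - z))\<^sup>2) \<partial>M)"
    by (rule Bochner_Integration.integral_cong)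
       (simp_all add: herglotz_kernel not_in_space[OF _ assms] Im_divide_of_real)
  finally show ?thesis by (simp only: integral_mult_right_zero)
qed

text \<open>
  The value \<open>1 / 0 = 0\<close> hides a point mass at \<open>x\<close> from \<open>poisson x\<close>;
  hence the first conjunct.
\<close>

definition finite_poisson :: "complex \<Rightarrow> bool" where
  "finite_poisson x \<longleftrightarrow> (AE w in M. w \<noteq> x) \<and> integrable M (\<lambda>w. 1 / (norm (w - x))\<^sup>2)"

section \<open>Finiteness at the boundary from radial bounds\<close>

text \<open>The bound first excludes an atom at \<open>x\<close>, whose mass is at most
  \<open>K * (1 - r)\<^sup>2\<close>; then Fatou's lemma bounds the integral at \<open>x\<close>
  itself.\<close>

lemma finite_poissonI:
  assumes x: "norm x = 1"
    and bound: "eventually (\<lambda>r. poisson (of_real r * x) \<le> K) (at_left 1)"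
  shows "finite_poisson x"
proof -
  \<comment> \<open>Fatou's lemma needs a sequence of radii; adding 2 keeps \<open>r 0\<close>
    strictly between 0 and 1.\<close>
  define r :: "nat \<Rightarrow> real" where "r n = 1 - 1 / (real n + 2)" for n
  have r: "0 < r n" "r n < 1" for n by (auto simp: r_def)
  have r_lim: "r \<longlonglongrightarrow> 1"
    unfolding r_def by real_asymp
  hence "filterlim r (at_left 1) sequentially"
    using r less_imp_neq[OF r(2)] by (auto simp: filterlim_at)
  hence ev: "eventually (\<lambda>n. poisson (of_real (r n) * x) \<le> K) sequentially"
    using bound by (auto simp: filterlim_iff)
  have nrx: "norm (of_real (r n) * x) < 1" for n
    using x r[of n] by (simp add: norm_mult)
  have nn: "(\<integral>\<^sup>+w. ennreal (1 / (norm (w - of_real (r n) * x))\<^sup>2) \<partial>M) = ennreal (poisson (of_real (r n) * x))" for n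
    unfolding poisson_def by (rule nn_integral_eq_integral[OF integrable_poisson[OF nrx]]) simp
  have meas: "{x} \<in> sets M"
    using x by (auto simp: sets_eq sets_restrict_space)
  have "measure M {x} \<le> 0"
  proof (rule tendsto_lowerbound)
    show "(\<lambda>n. K * (1 - r n)\<^sup>2) \<longlonglongrightarrow> 0"
      using r_lim by (auto intro!: tendsto_eq_intros)
    show "eventually (\<lambda>n. measure M {x} \<le> K * (1 - r n)\<^sup>2) sequentially"
      using ev
    proof eventually_elim
      case (elim n)
      have d: "norm (x - of_real (r n) * x) = 1 - r n"
        using x r[of n] by (simp add: norm_radial_diff)
      \<comment> \<open>At \<open>w = x\<close> the integrand of
        \<open>poisson (of_real (r n) * x)\<close> equals
        \<open>1 / (1 - r n)\<^sup>2\<close>.\<close>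
      have "(\<integral>w. indicator {x} w * (1 / (1 - r n)\<^sup>2) \<partial>M) \<le> poisson (of_real (r n) * x)"
        unfolding poisson_def
      proof (rule integral_mono[OF _ integrable_poisson[OF nrx]])
        show "integrable M (\<lambda>w. indicator {x} w * (1 / (1 - r n)\<^sup>2))"
          using meas by (intro integrable_mult_left integrable_real_indicator) (auto simp: less_top[symmetric])
      qed (auto simp: indicator_def d)
      hence "measure M {x} / (1 - r n)\<^sup>2 \<le> K"
        using elim meas by simp
      thus ?case using r[of n] by (simp add: divide_simps)
    qed
  qed simp
  hence "emeasure M {x} = 0"
    by (simp add: emeasure_eq_measure measure_le_0_iff)
  hence AE: "AE w in M. w \<noteq> x"
    using meas by (auto intro!: AE_I'[of "{x}"] simp: null_sets_def)
  \<comment> \<open>Pointwise convergence holds only off the null set \<open>{x}\<close>: at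
    \<open>w = x\<close> the approximants blow up, while the limit integrand reads
    \<open>1 / 0 = 0\<close>.\<close>
  have "(\<integral>\<^sup>+w. ennreal (1 / (norm (w - x))\<^sup>2) \<partial>M)
      = (\<integral>\<^sup>+w. liminf (\<lambda>n. ennreal (1 / (norm (w - of_real (r n) * x))\<^sup>2)) \<partial>M)"
  proof (rule nn_integral_cong_AE, use AE in eventually_elim)
    case (elim w)
    have "(\<lambda>n. ennreal (1 / (norm (w - of_real (r n) * x))\<^sup>2)) \<longlonglongrightarrow> ennreal (1 / (norm (w - x))\<^sup>2)"
      using r_lim elim by (intro tendsto_ennrealI) (auto intro!: tendsto_eq_intros)
    thus ?case by (rule lim_imp_Liminf[OF sequentially_bot, symmetric])
  qed
  also have "\<dots> \<le> liminf (\<lambda>n. \<integral>\<^sup>+w. ennreal (1 / (norm (w - of_real (r n) * x))\<^sup>2) \<partial>M)"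
    by (intro nn_integral_liminf measurable_compose[OF measurable_borel measurable_ennreal]) measurable
  also have "\<dots> \<le> ennreal K"
    unfolding nn
  proof (rule Liminf_le)
    show "eventually (\<lambda>n. ennreal (poisson (of_real (r n) * x)) \<le> ennreal K) sequentially"
      using ev by eventually_elim (rule ennreal_leI)
  qed simp
  finally have "(\<integral>\<^sup>+w. ennreal (1 / (norm (w - x))\<^sup>2) \<partial>M) < \<infinity>"
    by (simp add: le_less_trans)
  hence "integrable M (\<lambda>w. 1 / (norm (w - x))\<^sup>2)"
    by (intro integrableI_nonneg measurable_borel) auto
  thus ?thesis using AE by (simp add: finite_poisson_def)
qed

section \<open>Boundary value and angular expansion\<close>

text \<open>From \<open>|w + x| * |w - x| \<le> 4\<close> the kernel is at most 4 times the
  integrand of \<open>poisson x\<close>.\<close>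

lemma integrable_herglotz_boundary:
  assumes x: "norm x = 1" and fin: "finite_poisson x"
  shows "integrable M (\<lambda>w. (w + x) / (w - x))"
proof (rule Bochner_Integration.integrable_bound)
  show "integrable M (\<lambda>w. 4 * (1 / (norm (w - x))\<^sup>2))"
    using fin by (intro integrable_mult_right) (simp add: finite_poisson_def)
  have "AE w in M. w \<noteq> x" using fin by (simp add: finite_poisson_def)
  thus "AE w in M. norm ((w + x) / (w - x)) \<le> norm (4 * (1 / (norm (w - x))\<^sup>2))"
    using AE_space
  proof eventually_elim
    case (elim w)
    have "norm (w + x) * norm (w - x) \<le> 2 * 2"
      using norm_triangle_ineq[of w x] norm_triangle_ineq4[of w x] elim x
      by (intro mult_mono) auto
    thus ?case
      using elim by (simp add: norm_divide divide_simps power2_eq_square)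
  qed
qed (rule measurable_borel, measurable)+

lemma Re_herglotz_boundary:
  assumes x: "norm x = 1" and fin: "finite_poisson x"
  shows "Re (herglotz x) = 0"
proof -
  have "Re (herglotz x) = (\<integral>w. Re ((w + x) / (w - x)) \<partial>M)"
    unfolding herglotz_def using integrable_herglotz_boundary[OF assms] by (rule integral_Re[symmetric])
  also have "\<dots> = (\<integral>w. 0 \<partial>M)"
  proof (rule Bochner_Integration.integral_cong)
    fix w assume "w \<in> space M"
    \<comment> \<open>For \<open>w = x\<close> the quotient is 0 by the convention for division by
      zero; otherwise the factor \<open>1 - |x|^2\<close> vanishes.\<close>
    thus "Re ((w + x) / (w - x)) = 0"
      using x by (cases "w = x") (simp_all add: herglotz_kernel Re_divide_of_real)
  qed simp
  finally show ?thesis by simp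
qed

text \<open>The difference quotient is the integral of \<open>- 2 * w / ((w - z) * (w - x))\<close>,
  which is dominated in the angle by \<open>2 * (1 + R) / |w - x|^2\<close>; its limit kernel is a
  constant multiple of the integrand of \<open>poisson x\<close>.\<close>

lemma herglotz_expansion:
  assumes x: "norm x = 1" and fin: "finite_poisson x"
  shows "((\<lambda>z. (herglotz z - herglotz x) / (x - z)) \<longlongrightarrow> 2 * cnj x * poisson x) (at x within stolz_angle x R)"
  \<comment> \<open>Passing to sequences makes dominated convergence applicable.\<close>
  unfolding tendsto_at_iff_sequentially
proof (intro allI impI)
  fix X :: "nat \<Rightarrow> complex"
  assume X: "\<forall>i. X i \<in> stolz_angle x R - {x}" and lim: "X \<longlonglongrightarrow> x"
  have AE: "AE w in M. w \<noteq> x" and int: "integrable M (\<lambda>w. 1 / (norm (w - x))\<^sup>2)"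
    using fin by (simp_all add: finite_poisson_def)
  have nX: "norm (X i) < 1" "X i \<in> stolz_angle x R" "X i \<noteq> x" for i
    using X by (auto simp: stolz_angle_def)
  have eq: "(herglotz (X i) - herglotz x) / (x - X i)
      = - 2 * (\<integral>w. w / ((w - X i) * (w - x)) \<partial>M)" for i
  proof -
    have "(herglotz (X i) - herglotz x) / (x - X i)
        = (\<integral>w. ((w + X i) / (w - X i) - (w + x) / (w - x)) / (x - X i) \<partial>M)"
      unfolding herglotz_def
      using integrable_herglotz[OF nX(1)] integrable_herglotz_boundary[OF assms] by simp
    also have "\<dots> = (\<integral>w. - 2 * (w / ((w - X i) * (w - x))) \<partial>M)"
    proof (rule integral_cong_AE, goal_cases)
      case 3
      show ?case using AE AE_space
      proof eventually_elim
        case (elim w)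
        thus ?case using nX[of i] x by (intro herglotz_kernel_diff) auto
      qed
    qed (rule measurable_borel, measurable)+
    finally show ?thesis by (simp only: integral_mult_right_zero)
  qed
  have "(\<lambda>i. \<integral>w. w / ((w - X i) * (w - x)) \<partial>M) \<longlonglongrightarrow> (\<integral>w. w / (w - x)\<^sup>2 \<partial>M)"
  proof (rule integral_dominated_convergence)
    show "integrable M (\<lambda>w. (1 + R) * (1 / (norm (w - x))\<^sup>2))"
      using int by (rule integrable_mult_right)
    show "AE w in M. (\<lambda>i. w / ((w - X i) * (w - x))) \<longlonglongrightarrow> w / (w - x)\<^sup>2"
      using AE
      by eventually_elim (auto intro!: tendsto_eq_intros lim simp: power2_eq_square)
    show "AE w in M. norm (w / ((w - X i) * (w - x))) \<le> (1 + R) * (1 / (norm (w - x))\<^sup>2)" for i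
      using AE AE_space
    proof eventually_elim
      case (elim w)
      have "norm (w - x) \<le> (1 + R) * norm (w - X i)"
        using stolz_angle_approach[OF nX(2)] elim by simp
      moreover have "w \<noteq> X i" using not_in_space elim nX(1) by blast
      ultimately show ?case
        using elim by (simp add: norm_divide norm_mult power2_eq_square divide_simps)
    qed
  qed (rule measurable_borel, measurable)+
  also have "(\<integral>w. w / (w - x)\<^sup>2 \<partial>M) = (\<integral>w. - cnj x * of_real (1 / (norm (w - x))\<^sup>2) \<partial>M)"
  proof (rule integral_cong_AE, goal_cases)
    case 3
    show ?case using AE AE_space
      by eventually_elim (simp add: unit_circle_quotient x)
  qed (rule measurable_borel, measurable)+
  also have "\<dots> = - cnj x * poisson x"
    unfolding poisson_def by (simp only: integral_mult_right_zero integral_complex_of_real)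
  finally have "(\<lambda>i. - 2 * (\<integral>w. w / ((w - X i) * (w - x)) \<partial>M)) \<longlonglongrightarrow> - 2 * (- cnj x * poisson x)"
    by (intro tendsto_intros)
  thus "((\<lambda>z. (herglotz z - herglotz x) / (x - z)) \<circ> X) \<longlonglongrightarrow> 2 * cnj x * poisson x"
    by (simp add: o_def eq mult.assoc)
qed

section \<open>Radial limits and the two limit conditions\<close>

lemma herglotz_expansion_radial:
  assumes x: "norm x = 1" and fin: "finite_poisson x"
  shows "((\<lambda>r. (herglotz (of_real r * x) - herglotz x) / of_real (1 - r)) \<longlongrightarrow> of_real (2 * poisson x)) (at_left 1)"
proof -
  have xx: "x * cnj x = 1"
    using x by (simp add: complex_mult_cnj flip: cmod_power2)
  \<comment> \<open>Since \<open>x - r * x = x * (1 - r)\<close>, the factor \<open>x\<close> turns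
    the quotient into one by \<open>1 - r\<close> and cancels \<open>cnj x\<close>, which makes the
    limit real. The aperture 2 could be any number above 1.\<close>
  have "((\<lambda>r. x * ((herglotz (of_real r * x) - herglotz x) / (x - of_real r * x)))
      \<longlongrightarrow> x * (2 * cnj x * poisson x)) (at_left 1)"
    by (intro tendsto_intros filterlim_compose[OF herglotz_expansion[OF assms, of 2]]
        filterlim_radial_stolz_angle x) simp
  moreover have "x * (2 * cnj x * poisson x) = 2 * poisson x"
    using xx by (simp add: algebra_simps)
  moreover have "x * (a / (x - of_real r * x)) = a / of_real (1 - r)" for a r
  proof -
    have "x - of_real r * x = x * of_real (1 - r)" by (simp add: algebra_simps)
    moreover have "x \<noteq> 0" using x by auto
    ultimately show ?thesis by simp
  qed
  ultimately show ?thesis by simp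
qed

lemma herglotz_radial_limit:
  assumes x: "norm x = 1" and fin: "finite_poisson x"
  shows "((\<lambda>r. herglotz (of_real r * x)) \<longlongrightarrow> herglotz x) (at_left 1)"
proof -
  have "((\<lambda>r. herglotz x + of_real (1 - r) * ((herglotz (of_real r * x) - herglotz x) / of_real (1 - r)))
     \<longlongrightarrow> herglotz x + complex_of_real (1 - 1) * complex_of_real (2 * poisson x)) (at_left 1)"
    by (intro tendsto_intros herglotz_expansion_radial[OF assms])
  hence "((\<lambda>r. herglotz x + of_real (1 - r) * ((herglotz (of_real r * x) - herglotz x) / of_real (1 - r)))
     \<longlongrightarrow> herglotz x) (at_left 1)" by simp
  thus ?thesis
  proof (rule Lim_transform_eventually)
    show "\<forall>\<^sub>F r in at_left 1. herglotz x + of_real (1 - r) * ((herglotz (of_real r * x) - herglotz x) / of_real (1 - r))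
        = herglotz (of_real r * x)"
      using eventually_at_left_1
    proof eventually_elim
      case (elim r)
      hence "complex_of_real (1 - r) \<noteq> 0" by simp
      thus ?case by (simp del: of_real_diff)
    qed
  qed
qed

text \<open>The real part of the radial quotient is \<open>(1 + r) * poisson (r * x)\<close>,
  because \<open>Re (herglotz x) = 0\<close>; the factor \<open>1 + r\<close> accounts for the 2 in
  its limit \<open>2 * poisson x\<close>.\<close>

lemma poisson_radial_limit:
  assumes x: "norm x = 1" and fin: "finite_poisson x"
  shows "((\<lambda>r. poisson (of_real r * x)) \<longlongrightarrow> poisson x) (at_left 1)"
proof -
  have "((\<lambda>r. Re ((herglotz (of_real r * x) - herglotz x) / of_real (1 - r)) / (1 + r))
     \<longlongrightarrow> Re (2 * poisson x) / (1 + 1)) (at_left 1)"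
    by (intro tendsto_intros herglotz_expansion_radial[OF assms]) simp
  hence "((\<lambda>r. Re ((herglotz (of_real r * x) - herglotz x) / of_real (1 - r)) / (1 + r))
     \<longlongrightarrow> poisson x) (at_left 1)" by simp
  thus ?thesis
  proof (rule Lim_transform_eventually)
    show "\<forall>\<^sub>F r in at_left 1. Re ((herglotz (of_real r * x) - herglotz x) / of_real (1 - r)) / (1 + r)
        = poisson (of_real r * x)"
      using eventually_at_left_1
    proof eventually_elim
      case (elim r)
      hence "Re (herglotz (of_real r * x)) = (1 - r) * (1 + r) * poisson (of_real r * x)"
        using x by (simp add: Re_herglotz norm_mult power2_eq_square algebra_simps)
      thus ?case
        using elim by (simp add: Re_divide_of_real Re_herglotz_boundary[OF assms] del: of_real_diff)
    qed
  qed
qed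

lemma poisson_limit_iff:
  assumes x: "norm x = 1"
  shows "(\<exists>L. ((\<lambda>r. poisson (of_real r * x)) \<longlongrightarrow> L) (at_left 1)) \<longleftrightarrow> finite_poisson x"
proof
  assume "\<exists>L. ((\<lambda>r. poisson (of_real r * x)) \<longlongrightarrow> L) (at_left 1)"
  then obtain L where "((\<lambda>r. poisson (of_real r * x)) \<longlongrightarrow> L) (at_left 1)" ..
  hence "eventually (\<lambda>r. poisson (of_real r * x) < L + 1) (at_left 1)"
    by (rule order_tendstoD) simp
  hence "eventually (\<lambda>r. poisson (of_real r * x) \<le> L + 1) (at_left 1)"
    by (rule eventually_mono) simp
  thus "finite_poisson x" by (rule finite_poissonI[OF x])
qed (use poisson_radial_limit[OF x] in blast)

text \<open>If \<open>herglotz x = 0\<close>, the quotient is the imaginary part of one with a real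
  limit. Conversely, multiplying by \<open>1 - r\<close> shows that the imaginary part of
  \<open>herglotz x\<close> is 0, and its real part is 0 anyway.\<close>

lemma Im_herglotz_limit_iff:
  assumes x: "norm x = 1" and fin: "finite_poisson x"
  shows "((\<lambda>r. Im (herglotz (of_real r * x)) / (1 - r)) \<longlongrightarrow> 0) (at_left 1) \<longleftrightarrow> herglotz x = 0"
proof
  assume "herglotz x = 0"
  moreover have "((\<lambda>r. Im ((herglotz (of_real r * x) - herglotz x) / of_real (1 - r)))
     \<longlongrightarrow> Im (2 * poisson x)) (at_left 1)"
    by (intro tendsto_intros herglotz_expansion_radial[OF assms])
  ultimately show "((\<lambda>r. Im (herglotz (of_real r * x)) / (1 - r)) \<longlongrightarrow> 0) (at_left 1)"
    by (simp add: Im_divide_of_real del: of_real_diff)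
next
  assume "((\<lambda>r. Im (herglotz (of_real r * x)) / (1 - r)) \<longlongrightarrow> 0) (at_left 1)"
  hence "((\<lambda>r. (1 - r) * (Im (herglotz (of_real r * x)) / (1 - r))) \<longlongrightarrow> (1 - 1) * 0) (at_left 1)"
    by (intro tendsto_intros)
  hence "((\<lambda>r. (1 - r) * (Im (herglotz (of_real r * x)) / (1 - r))) \<longlongrightarrow> 0) (at_left 1)" by simp
  hence "((\<lambda>r. Im (herglotz (of_real r * x))) \<longlongrightarrow> 0) (at_left 1)"
    by (rule Lim_transform_eventually) (rule eventually_mono[OF eventually_at_left_1], simp)
  moreover have "((\<lambda>r. Im (herglotz (of_real r * x))) \<longlongrightarrow> Im (herglotz x)) (at_left 1)"
    by (intro tendsto_intros herglotz_radial_limit[OF assms])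
  ultimately have "Im (herglotz x) = 0"
    by (intro tendsto_unique[of "at_left (1::real)"]) auto
  thus "herglotz x = 0"
    using Re_herglotz_boundary[OF assms] by (simp add: complex_eq_iff)
qed

text \<open>Dividing \<open>Re (herglotz (r * x)) = (1 - r) * (1 + r) * poisson (r * x)\<close> by
  \<open>1 - r\<close> and using \<open>1 + r \<ge> 1\<close> bounds \<open>poisson\<close> by
  \<open>K\<close>. The radial limit of \<open>herglotz\<close> then exists and must be 0.\<close>

lemma herglotz_radial_bound:
  assumes x: "norm x = 1"
    and bound: "eventually (\<lambda>r. norm (herglotz (of_real r * x)) \<le> K * (1 - r)) (at_left 1)"
  shows "finite_poisson x" "herglotz x = 0"
proof -
  have "eventually (\<lambda>r. poisson (of_real r * x) \<le> K) (at_left 1)"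
    using bound eventually_at_left_1
  proof eventually_elim
    case (elim r)
    have P: "0 \<le> poisson (of_real r * x)" by (simp add: poisson_def)
    have "(1 - r) * (poisson (of_real r * x) * (1 + r)) = Re (herglotz (of_real r * x))"
      using elim x by (simp add: Re_herglotz norm_mult power2_eq_square algebra_simps)
    also have "\<dots> \<le> (1 - r) * K"
      using elim abs_Re_le_cmod[of "herglotz (of_real r * x)"] by (simp add: mult.commute)
    finally have "poisson (of_real r * x) * (1 + r) \<le> K" using elim by simp
    moreover have "0 \<le> poisson (of_real r * x) * r" using P elim by simp
    ultimately show ?case by (simp add: algebra_simps)
  qed
  thus fin: "finite_poisson x" by (rule finite_poissonI[OF x])
  have "((\<lambda>r. herglotz (of_real r * x)) \<longlongrightarrow> 0) (at_left 1)"
  proof (rule Lim_null_comparison[OF bound])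
    have "((\<lambda>r. K * (1 - r)) \<longlongrightarrow> K * (1 - 1)) (at_left 1)" by (intro tendsto_intros)
    thus "((\<lambda>r. K * (1 - r)) \<longlongrightarrow> 0) (at_left 1)" by simp
  qed
  thus "herglotz x = 0"
    by (intro tendsto_unique[OF _ herglotz_radial_limit[OF x fin]]) auto
qed

lemma poisson_pos:
  assumes "finite_poisson x" and "herglotz z \<noteq> 0"
  shows "poisson x > 0"
proof (rule ccontr)
  assume "\<not> poisson x > 0"
  moreover have "poisson x \<ge> 0" by (simp add: poisson_def)
  ultimately have "poisson x = 0" by simp
  hence "AE w in M. 1 / (norm (w - x))\<^sup>2 = 0"
    using assms(1) unfolding poisson_def finite_poisson_def
    by (subst (asm) integral_nonneg_eq_0_iff_AE) auto
  moreover have "AE w in M. w \<noteq> x" using assms(1) by (simp add: finite_poisson_def)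
  \<comment> \<open>The two facts contradict each other at every point, so \<open>M\<close> is the
    zero measure and anything holds almost everywhere.\<close>
  ultimately have "AE w in M. (w + z) / (w - z) = 0"
    by eventually_elim simp
  hence "herglotz z = 0"
    unfolding herglotz_def by (rule integral_eq_zero_AE)
  thus False using assms(2) by simp
qed

end

section \<open>Regular poles of the generator\<close>

text \<open>The case \<open>x = \<tau>\<close> is a true exception: there the two Berkson-Porta
  factors contribute \<open>|x - z|^2\<close>, so \<open>|G z * (x - z)|\<close> tends to 0 at
  \<open>x\<close> within Stolz angles when both limit conditions hold.\<close>

theorem proposition6p1:
  fixes G p :: "complex \<Rightarrow> complex" and \<tau> x :: complex and \<theta> :: real
    and \<mu> :: "complex measure"
  assumes G: "inf_generator G"
    and G_nz: "\<exists>z\<in>ball 0 1. G z \<noteq> 0"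
    and \<tau>: "\<tau> \<in> cball 0 1"
    and p_holo: "p holomorphic_on ball 0 1"
    and p_Re: "\<And>z. z \<in> ball 0 1 \<Longrightarrow> Re (p z) \<ge> 0"
    and BP: "\<And>z. z \<in> ball 0 1 \<Longrightarrow> G z = (z - \<tau>) * (cnj \<tau> * z - 1) * p z"
    and x: "x = cis \<theta>"
    and x_neq: "x \<noteq> \<tau>"
    and \<mu>_fin: "finite_measure \<mu>"
    and \<mu>_sets: "sets \<mu> = sets (restrict_space borel (sphere 0 1))"
    and \<mu>: "\<And>z. z \<in> ball 0 1 \<Longrightarrow>
        1 / p z = 1 / (2 * pi) * circle_integral \<mu> (\<lambda>t. (cis t + z) / (cis t - z))"
  shows "regular_pole G x \<longleftrightarrow>
      (\<exists>L::real. ((\<lambda>r. circle_integral \<mu> (\<lambda>t. 1 / (norm (cis t - r * cis \<theta>))\<^sup>2))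
         \<longlongrightarrow> L) (at_left 1)) \<and>
      ((\<lambda>r. circle_integral \<mu>
            (\<lambda>t. sin (t - \<theta>) / (norm (cis t - r * cis \<theta>))\<^sup>2 * (1 / (1 - r))))
         \<longlongrightarrow> 0) (at_left 1)"
proof -
  interpret circle_measure \<mu>
    using \<mu>_fin \<mu>_sets by (simp add: circle_measure_def circle_measure_axioms_def)
  have nx: "norm x = 1" using x by simp
  have H: "circle_integral \<mu> (\<lambda>t. (cis t + z) / (cis t - z)) = herglotz z" for z
    using circle_integral_cis[of "\<lambda>w. (w + z) / (w - z)"] by (simp add: herglotz_def)
  have P: "circle_integral \<mu> (\<lambda>t. 1 / (norm (cis t - r * cis \<theta>))\<^sup>2) = poisson (of_real r * x)" for r
    using circle_integral_cis[of "\<lambda>w. 1 / (norm (w - of_real r * x))\<^sup>2"] by (simp add: poisson_def x)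
  \<comment> \<open>The factor \<open>- 1 / (2 * r)\<close> comes from
    \<open>Im (r * x * cnj (cis t)) = - r * sin (t - \<theta>)\<close> and from the 2 in
    \<open>Im_herglotz\<close>.\<close>
  have S: "circle_integral \<mu> (\<lambda>t. sin (t - \<theta>) / (norm (cis t - r * cis \<theta>))\<^sup>2 * (1 / (1 - r)))
      = - (1 / (2 * r)) * (Im (herglotz (of_real r * x)) / (1 - r))" if "0 < r \<and> r < 1" for r
  proof -
    have kernel: "sin (t - \<theta>) / (norm (cis t - r * cis \<theta>))\<^sup>2 * (1 / (1 - r))
        = - (1 / (r * (1 - r))) * (Im (of_real r * x * cnj (cis t)) / (norm (cis t - of_real r * x))\<^sup>2)" for t
    proof -
      have "Im (of_real r * x * cnj (cis t)) = - r * sin (t - \<theta>)"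
        by (simp add: x sin_diff algebra_simps)
      thus ?thesis using that by (simp add: x)
    qed
    have "circle_integral \<mu> (\<lambda>t. sin (t - \<theta>) / (norm (cis t - r * cis \<theta>))\<^sup>2 * (1 / (1 - r)))
        = (\<integral>w. - (1 / (r * (1 - r))) * (Im (of_real r * x * cnj w) / (norm (w - of_real r * x))\<^sup>2) \<partial>\<mu>)"
      unfolding circle_integral_cis[symmetric] kernel ..
    also have "\<dots> = - (1 / (r * (1 - r))) * (Im (herglotz (of_real r * x)) / 2)"
      using Im_herglotz[of "of_real r * x"] that nx
      by (simp only: integral_mult_right_zero) (simp add: norm_mult)
    finally show ?thesis by simp
  qed
  \<comment> \<open>Inverting twice is valid even at a zero of \<open>p\<close>, since
    \<open>1 / 0 = 0\<close>.\<close>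
  have p_eq: "p z = of_real (2 * pi) / herglotz z" if "z \<in> ball 0 1" for z
  proof -
    have "p z = 1 / (1 / p z)" by simp
    also have "1 / p z = herglotz z / of_real (2 * pi)" using \<mu>[OF that] by (simp add: H)
    finally show ?thesis by simp
  qed
  \<comment> \<open>Where \<open>G\<close> does not vanish, neither does \<open>p\<close>, hence
    neither does \<open>herglotz\<close>; this excludes the zero measure.\<close>
  obtain z0 where z0: "herglotz z0 \<noteq> 0"
    using G_nz BP p_eq by force
  have sine_iff: "((\<lambda>r. circle_integral \<mu>
            (\<lambda>t. sin (t - \<theta>) / (norm (cis t - r * cis \<theta>))\<^sup>2 * (1 / (1 - r))))
         \<longlongrightarrow> 0) (at_left 1) \<longleftrightarrow> ((\<lambda>r. Im (herglotz (of_real r * x)) / (1 - r)) \<longlongrightarrow> 0) (at_left 1)"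
    (is "(?S \<longlongrightarrow> 0) _ \<longleftrightarrow> (?J \<longlongrightarrow> 0) _")
  proof
    assume "(?S \<longlongrightarrow> 0) (at_left 1)"
    hence "((\<lambda>r. - (2 * r) * ?S r) \<longlongrightarrow> - (2 * 1) * 0) (at_left 1)" by (intro tendsto_intros)
    hence "((\<lambda>r. - (2 * r) * ?S r) \<longlongrightarrow> 0) (at_left 1)" by simp
    thus "(?J \<longlongrightarrow> 0) (at_left 1)"
      by (rule Lim_transform_eventually) (rule eventually_mono[OF eventually_at_left_1], subst S, simp_all)
  next
    assume "(?J \<longlongrightarrow> 0) (at_left 1)"
    hence "((\<lambda>r. - (1 / (2 * r)) * ?J r) \<longlongrightarrow> - (1 / (2 * 1)) * 0) (at_left 1)" by (intro tendsto_intros) auto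
    hence "((\<lambda>r. - (1 / (2 * r)) * ?J r) \<longlongrightarrow> 0) (at_left 1)" by simp
    thus "(?S \<longlongrightarrow> 0) (at_left 1)"
      by (rule Lim_transform_eventually) (rule eventually_mono[OF eventually_at_left_1], subst S, simp_all)
  qed
  have "regular_pole G x \<longleftrightarrow> finite_poisson x \<and> herglotz x = 0"
  proof
    assume "regular_pole G x"
    then obtain C where C: "C > 0" "angular_liminf x (\<lambda>z. norm (G z * (x - z))) = ereal C"
      by (auto simp: regular_pole_def)
    \<comment> \<open>One Stolz angle containing the radius suffices here; the strict bound by
      \<open>C / 2\<close> below turns the lower limit into an eventual inequality.\<close>
    have "ereal C \<le> Liminf (at x within stolz_angle x 2) (\<lambda>z. ereal (norm (G z * (x - z))))"
      unfolding C(2)[symmetric] angular_liminf_def by (rule INF_lower) simp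
    hence "ereal (C / 2) < Liminf (at x within stolz_angle x 2) (\<lambda>z. ereal (norm (G z * (x - z))))"
      by (rule less_le_trans[rotated]) (use C(1) in simp)
    hence "eventually (\<lambda>z. ereal (C / 2) < ereal (norm (G z * (x - z)))) (at x within stolz_angle x 2)"
      by (rule less_LiminfD)
    hence "eventually (\<lambda>r. C / 2 < norm (G (of_real r * x) * (x - of_real r * x))) (at_left 1)"
      using filterlim_radial_stolz_angle[OF nx, of 2] by (auto simp: filterlim_iff)
    \<comment> \<open>Both Berkson-Porta factors are at most 2 in norm, so
      \<open>C / 2 < 4 * 2 * pi * (1 - r) / |herglotz z|\<close>, which gives the constant
      \<open>16 * pi / C\<close>.\<close>
    hence "eventually (\<lambda>r. norm (herglotz (of_real r * x)) \<le> (16 * pi / C) * (1 - r)) (at_left 1)"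
      using eventually_at_left_1
    proof eventually_elim
      case (elim r)
      define z where "z = of_real r * x"
      have z: "norm z < 1" using elim nx by (simp add: z_def norm_mult)
      have xz: "norm (x - z) = 1 - r" using elim nx by (simp add: z_def norm_radial_diff)
      have n1: "norm (z - \<tau>) \<le> 2" using norm_triangle_ineq4[of z \<tau>] z \<tau> by simp
      have "norm (cnj \<tau> * z) \<le> 1 * 1" unfolding norm_mult using z \<tau> by (intro mult_mono) auto
      hence n2: "norm (cnj \<tau> * z - 1) \<le> 2" using norm_triangle_ineq4[of "cnj \<tau> * z" 1] by simp
      have "C / 2 < norm (G z * (x - z))" using elim by (simp add: z_def)
      also have "\<dots> = (norm (z - \<tau>) * norm (cnj \<tau> * z - 1)) * (2 * pi * (1 - r) / norm (herglotz z))"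
        using z by (simp add: BP p_eq norm_mult norm_divide xz)
      also have "\<dots> \<le> (2 * 2) * (2 * pi * (1 - r) / norm (herglotz z))"
        using n1 n2 elim by (intro mult_right_mono mult_mono) auto
      finally have *: "C / 2 < 8 * pi * (1 - r) / norm (herglotz z)" by simp
      \<comment> \<open>Otherwise the right-hand side of \<open>*\<close> would be 0 by division by
        zero.\<close>
      hence "norm (herglotz z) \<noteq> 0" using C(1) by auto
      hence "C / 2 * norm (herglotz z) < 8 * pi * (1 - r)"
        using * by (simp add: pos_less_divide_eq)
      thus ?case using C(1) unfolding z_def[symmetric] by (simp add: field_simps)
    qed
    thus "finite_poisson x \<and> herglotz x = 0" using herglotz_radial_bound[OF nx] by blast
  next
    assume *: "finite_poisson x \<and> herglotz x = 0"
    define I where "I = poisson x"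
    have I: "I > 0" unfolding I_def using poisson_pos * z0 by blast
    \<comment> \<open>The angular limit of \<open>|G z * (x - z)|\<close>:
      \<open>p = 2 * pi / herglotz\<close>, and \<open>herglotz z / (x - z)\<close> tends to
      \<open>2 * cnj x * I\<close>.\<close>
    define C where "C = norm (x - \<tau>) * norm (cnj \<tau> * x - 1) * (2 * pi / norm (2 * cnj x * I))"
    have "cnj \<tau> * x \<noteq> 1"
    proof
      assume eq: "cnj \<tau> * x = 1"
      have "x * cnj x = 1" using nx by (simp add: complex_mult_cnj flip: cmod_power2)
      hence "cnj \<tau> = (cnj \<tau> * x) * cnj x" by (simp add: mult.assoc)
      also have "\<dots> = cnj x" by (simp add: eq)
      finally have "\<tau> = x" by simp
      thus False using x_neq by simp
    qed
    hence C: "C > 0" unfolding C_def using x_neq nx I by (auto simp: norm_mult)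
    \<comment> \<open>The limit is the same in every Stolz angle, so the infimum over
      \<open>R\<close> is again \<open>C\<close>.\<close>
    have "Liminf (at x within stolz_angle x R) (\<lambda>z. ereal (norm (G z * (x - z)))) = ereal C" if "R > 1" for R
    proof (rule lim_imp_Liminf)
      \<comment> \<open>A limit determines the lower limit only along a nontrivial filter; the
        radius shows that \<open>x\<close> is approached inside the angle.\<close>
      show "at x within stolz_angle x R \<noteq> bot"
      proof
        assume "at x within stolz_angle x R = bot"
        hence "eventually (\<lambda>r::real. False) (at_left 1)"
          using filterlim_radial_stolz_angle[OF nx that]
          unfolding filterlim_iff by (auto dest: spec[of _ "\<lambda>_. False"])
        thus False by simp
      qed
      have "((\<lambda>z. herglotz z / (x - z)) \<longlongrightarrow> 2 * cnj x * I) (at x within stolz_angle x R)"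
        using herglotz_expansion[OF nx, of R] * by (simp add: I_def)
      hence "((\<lambda>z. norm (z - \<tau>) * norm (cnj \<tau> * z - 1) * (2 * pi / norm (herglotz z / (x - z)))) \<longlongrightarrow> C)
          (at x within stolz_angle x R)"
        unfolding C_def using I nx by (intro tendsto_intros) auto
      hence "((\<lambda>z. norm (G z * (x - z))) \<longlongrightarrow> C) (at x within stolz_angle x R)"
      proof (rule Lim_transform_eventually)
        show "eventually (\<lambda>z. norm (z - \<tau>) * norm (cnj \<tau> * z - 1) * (2 * pi / norm (herglotz z / (x - z)))
            = norm (G z * (x - z))) (at x within stolz_angle x R)"
          unfolding eventually_at_filter
          by (rule always_eventually)
             (auto simp: stolz_angle_def BP p_eq norm_mult norm_divide)
      qed
      thus "((\<lambda>z. ereal (norm (G z * (x - z)))) \<longlongrightarrow> ereal C) (at x within stolz_angle x R)"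
        by simp
    qed
    hence "angular_liminf x (\<lambda>z. norm (G z * (x - z))) = (INF R\<in>{1::real<..}. ereal C)"
      unfolding angular_liminf_def by (intro INF_cong) auto
    moreover have "{1::real<..} \<noteq> {}" by (simp add: ex_in_conv[symmetric] gt_ex)
    ultimately show "regular_pole G x"
      using C nx by (auto simp: regular_pole_def)
  qed
  also have "\<dots> \<longleftrightarrow> finite_poisson x \<and> ((\<lambda>r. Im (herglotz (of_real r * x)) / (1 - r)) \<longlongrightarrow> 0) (at_left 1)"
    using Im_herglotz_limit_iff[OF nx] by blast
  finally show ?thesis
    unfolding P sine_iff poisson_limit_iff[OF nx] .
qed

end
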